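(* For every $k \geq 1$, all pattern sets of the form $[1342,\sigma(w)]$, where $w$ is a binary word of length $k$ with more than two runs, are Wilf equivalent.
   Context: A run of a binary word is a maximal block of consecutive equal letters. For a binary word $w=w_1\cdots w_{n-1}$, $\sigma(w)=\sigma_1\cdots\sigma_n$ is the permutation of $[n]$ where, for $k=1,\dots,n-1$, $\sigma_k$ is the minimum of the unused values of $[n]$ if $w_k=0$ and the maximum if $w_k=1$, and $\sigma_n$ is the remaining value. A circular permutation $[\pi]$ of size $n$ is the set of all rotations of a permutation $\pi$ of $[n]$; $[\sigma]$ contains $[\pi]$ if some rotation of $\sigma$ has a subsequence order-isomorphic to $\pi$, otherwise avoids it. $\mathrm{Av}_n[\pi_1,\dots,\pi_m]$ is the set of circular permutations of size $n$ avoiding each $[\pi_i]$; two pattern sets are Wilf equivalent if their $\mathrm{Av}_n$ have equal cardinality for every $n\ge 1$. *)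

theory Defs
  imports
    "HOL-Library.Sublist"
    "HOL-Combinatorics.Multiset_Permutations"
begin

text \<open>
  A permutation of \<open>[n]\<close> is written in one-line notation, as an element of
  \<^term>\<open>permutations_of_set {1..n::nat}\<close>.  Binary words are lists of Booleans, with
  \<^term>\<open>False\<close> for the letter 0 and \<^term>\<open>True\<close> for the letter 1.
\<close>

section \<open>Binary words\<close>

text \<open>
  The pair \<open>(i, j)\<close> stands for the block of positions \<open>i, \<dots>, j - 1\<close> (counted from 0).
\<close>

definition runs :: "bool list \<Rightarrow> (nat \<times> nat) set" where
  "runs w = {(i, j). i < j \<and> j \<le> length w \<and>
     (\<forall>l. i \<le> l \<and> l < j \<longrightarrow> w ! l = w ! i) \<and>
     (i = 0 \<or> w ! (i - 1) \<noteq> w ! i) \<and>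
     (j = length w \<or> w ! j \<noteq> w ! i)}"

lemma finite_runs: "finite (runs w)"
  by (rule finite_subset[of _ "{..length w} \<times> {..length w}"]) (auto simp: runs_def)

text \<open>The argument \<open>U\<close> is the set of unused values.\<close>

fun perm_of_word_from :: "nat set \<Rightarrow> bool list \<Rightarrow> nat list" where
  "perm_of_word_from U [] = [the_elem U]"
| "perm_of_word_from U (b # w) =
     (let v = (if b then Max U else Min U) in v # perm_of_word_from (U - {v}) w)"

definition perm_of_word :: "bool list \<Rightarrow> nat list" where
  "perm_of_word w = perm_of_word_from {1..length w + 1} w"

lemma perm_of_word_from_permutation:
  "finite U \<Longrightarrow> card U = length w + 1 \<Longrightarrow>
     perm_of_word_from U w \<in> permutations_of_set U"
proof (induction w arbitrary: U)
  case Nil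
  then show ?case by (auto simp: card_1_singleton_iff permutations_of_set_def)
next
  case (Cons b w)
  define v where "v = (if b then Max U else Min U)"
  from Cons.prems have "U \<noteq> {}" by auto
  with Cons.prems have v: "v \<in> U" by (simp add: v_def)
  with Cons.prems have "perm_of_word_from (U - {v}) w \<in> permutations_of_set (U - {v})"
    by (intro Cons.IH) auto
  moreover have "perm_of_word_from U (b # w) = v # perm_of_word_from (U - {v}) w"
    by (simp add: v_def Let_def)
  ultimately show ?case using v by (auto simp: permutations_of_set_def)
qed

lemma perm_of_word_permutation:
  "perm_of_word w \<in> permutations_of_set {1..length w + 1}"
  unfolding perm_of_word_def by (rule perm_of_word_from_permutation) auto


section \<open>Pattern containment for circular permutations\<close>

definition order_iso :: "nat list \<Rightarrow> nat list \<Rightarrow> bool" where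
  "order_iso xs ys \<longleftrightarrow> length xs = length ys \<and>
     (\<forall>i < length xs. \<forall>j < length xs. xs ! i < xs ! j \<longleftrightarrow> ys ! i < ys ! j)"

definition contains :: "nat list \<Rightarrow> nat list \<Rightarrow> bool" where
  "contains \<sigma> \<pi> \<longleftrightarrow> (\<exists>t. subseq t \<sigma> \<and> order_iso t \<pi>)"

definition circ :: "nat list \<Rightarrow> nat list set" where
  "circ \<pi> = {rotate i \<pi> | i. True}"

definition circ_perms :: "nat \<Rightarrow> nat list set set" where
  "circ_perms n = circ ` permutations_of_set {1..n}"

text \<open>
  Containment is a relation between circular permutations; here the representative of the
  pattern is arbitrary as well.  The lemma \<open>circ_contains_circ\<close> below shows that it may be
  fixed, so that only the rotations of the containing permutation matter.
\<close>

definition circ_contains :: "nat list set \<Rightarrow> nat list set \<Rightarrow> bool" where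
  "circ_contains S P \<longleftrightarrow> (\<exists>\<sigma> \<in> S. \<exists>\<pi> \<in> P. contains \<sigma> \<pi>)"

definition Av :: "nat \<Rightarrow> nat list set set \<Rightarrow> nat list set set" where
  "Av n B = {S \<in> circ_perms n. \<forall>P \<in> B. \<not> circ_contains S P}"

definition Wilf_equivalent :: "nat list set set \<Rightarrow> nat list set set \<Rightarrow> bool" where
  "Wilf_equivalent B B' \<longleftrightarrow> (\<forall>n \<ge> 1. card (Av n B) = card (Av n B'))"

lemma finite_Av: "finite (Av n B)"
  by (simp add: Av_def circ_perms_def)

lemma order_iso_rotate:
  assumes "order_iso xs ys"
  shows "order_iso (rotate m xs) (rotate m ys)"
proof -
  have len: "length xs = length ys" using assms by (simp add: order_iso_def)
  have "(m + i) mod length ys < length ys" if "i < length ys" for i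
    using that by (intro mod_less_divisor) auto
  with assms len show ?thesis by (auto simp: order_iso_def nth_rotate)
qed

lemma subseq_rotate1:
  assumes "subseq t s"
  shows "\<exists>i. subseq (rotate1 t) (rotate i s)"
proof (cases t)
  case Nil
  then show ?thesis by simp
next
  case (Cons x us)
  with assms obtain a b where s: "s = a @ x # b" and us: "subseq us b"
    by (auto dest: list_emb_ConsD)
  have "rotate (length (a @ [x])) ((a @ [x]) @ b) = b @ a @ [x]"
    by (subst rotate_append) simp
  moreover have "subseq (us @ [x]) (b @ a @ [x])"
    using us by (intro list_emb_append_mono) auto
  ultimately show ?thesis using s Cons by (metis append.assoc append_Cons append_Nil rotate1.simps(2))
qed

lemma subseq_rotate:
  assumes "subseq t s"
  shows "\<exists>i. subseq (rotate m t) (rotate i s)"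
proof (induction m)
  case 0
  show ?case using assms by (auto intro: exI[of _ 0])
next
  case (Suc m)
  then obtain i where "subseq (rotate m t) (rotate i s)" by blast
  from subseq_rotate1[OF this] show ?case by (auto simp: rotate_rotate)
qed

lemma circ_contains_circ:
  "circ_contains (circ \<sigma>) (circ \<pi>) \<longleftrightarrow> (\<exists>i. contains (rotate i \<sigma>) \<pi>)"
proof
  assume "circ_contains (circ \<sigma>) (circ \<pi>)"
  then obtain i j t where t: "subseq t (rotate i \<sigma>)" "order_iso t (rotate j \<pi>)"
    by (auto simp: circ_contains_def circ_def contains_def)
  define m where "m = length \<pi> * j - j"
  have "rotate m (rotate j \<pi>) = \<pi>"
  proof (cases "\<pi> = []")
    case False
    then have "j \<le> length \<pi> * j" by (cases \<pi>) auto
    then have "m + j = length \<pi> * j" by (simp add: m_def)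
    then show ?thesis by (simp add: rotate_rotate rotate_id)
  qed simp
  then have "order_iso (rotate m t) \<pi>"
    using order_iso_rotate[OF t(2), of m] by simp
  moreover obtain l where "subseq (rotate m t) (rotate l (rotate i \<sigma>))"
    using subseq_rotate[OF t(1)] by blast
  ultimately show "\<exists>i. contains (rotate i \<sigma>) \<pi>"
    by (auto simp: contains_def rotate_rotate)
next
  assume "\<exists>i. contains (rotate i \<sigma>) \<pi>"
  moreover have "\<pi> \<in> circ \<pi>" by (auto simp: circ_def intro: exI[of _ 0])
  ultimately show "circ_contains (circ \<sigma>) (circ \<pi>)"
    by (auto simp: circ_contains_def circ_def)
qed

end

theory Submission
  imports Defs
begin

text \<open>
  The circular permutations avoiding \<open>[1342]\<close> are exactly the \<open>[\<sigma>(u)]\<close>.  Deleting entries of \<open>\<sigma>(u)\<close>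
  amounts to deleting letters of \<open>u\<close>, and \<open>[\<sigma>(w)]\<close> determines \<open>w\<close> as soon as \<open>w\<close> has more than two
  runs.  So for such \<open>w\<close> the circular permutation \<open>[\<sigma>(u)]\<close> contains \<open>[\<sigma>(w)]\<close> iff \<open>w\<close> is a subsequence
  of \<open>u\<close>, and the claim reduces to the fact that the number of binary words of length \<open>n\<close> without
  the subsequence \<open>w\<close> depends only on the length of \<open>w\<close>.  The words \<open>u\<close> with at most two runs, on
  which \<open>u \<mapsto> [\<sigma>(u)]\<close> is not injective, never contain \<open>w\<close> and contribute a term independent of \<open>w\<close>.
\<close>

text \<open>Captures the order type of \<open>perm_of_word w\<close>: each letter tells whether its
  entry is the largest or the smallest of the suffix it starts, and the last entry has no letter. No
  set of values is mentioned, so the notion also applies to subsequences and rotations.\<close>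

fun has_word :: "bool list \<Rightarrow> nat list \<Rightarrow> bool" where
  "has_word [] xs \<longleftrightarrow> length xs = 1"
| "has_word (b # w) [] \<longleftrightarrow> False"
| "has_word (b # w) (x # xs) \<longleftrightarrow>
     (\<forall>y \<in> set xs. if b then y < x else x < y) \<and> has_word w xs"

lemma has_word_length: "has_word w xs \<Longrightarrow> length xs = length w + 1"
  by (induction w xs rule: has_word.induct) auto

lemma has_word_not_Nil: "has_word w xs \<Longrightarrow> xs \<noteq> []"
  using has_word_length by fastforce

lemma has_word_perm_of_word_from:
  "finite U \<Longrightarrow> card U = length w + 1 \<Longrightarrow> has_word w (perm_of_word_from U w)"
proof (induction w arbitrary: U)
  case (Cons b w)
  define v where "v = (if b then Max U else Min U)"
  from Cons.prems have "U \<noteq> {}" by auto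
  with Cons.prems have v: "v \<in> U" by (simp add: v_def)
  then have card: "finite (U - {v})" "card (U - {v}) = length w + 1" using Cons.prems by auto
  then have "set (perm_of_word_from (U - {v}) w) = U - {v}"
    using perm_of_word_from_permutation by (auto simp: permutations_of_set_def)
  moreover have "if b then y < v else v < y" if "y \<in> U - {v}" for y
    using that Cons.prems by (auto simp: v_def order.strict_iff_order)
  moreover have "perm_of_word_from U (b # w) = v # perm_of_word_from (U - {v}) w"
    by (simp add: v_def Let_def)
  ultimately show ?case using Cons.IH[OF card] by simp
qed simp

lemma has_word_perm_of_word: "has_word w (perm_of_word w)"
  unfolding perm_of_word_def by (rule has_word_perm_of_word_from) auto

lemma has_word_unique_perm:
  "has_word w xs \<Longrightarrow> distinct xs \<Longrightarrow> xs = perm_of_word_from (set xs) w"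
proof (induction w xs rule: has_word.induct)
  case (1 xs)
  then show ?case by (cases xs) auto
next
  case (3 b w x xs)
  have "(if b then Max (set (x # xs)) else Min (set (x # xs))) = x"
    using 3 by (cases b) (auto intro!: Max_eqI Min_eqI intro: less_imp_le)
  moreover have "set (x # xs) - {x} = set xs" using 3 by auto
  ultimately have "perm_of_word_from (set (x # xs)) (b # w) = x # perm_of_word_from (set xs) w"
    by (simp only: perm_of_word_from.simps Let_def)
  then show ?case using 3 by simp
qed simp

text \<open>An entry that carries a letter is followed by another entry, and comparing the two
  decides the letter.\<close>

lemma has_word_unique_word: "has_word v xs \<Longrightarrow> has_word w xs \<Longrightarrow> v = w"
proof (induction v xs arbitrary: w rule: has_word.induct)
  case (1 xs)
  then show ?case using has_word_length[of w xs] by simp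
next
  case (3 b v x xs)
  have "length w = Suc (length v)" using 3(2,3)[THEN has_word_length] by simp
  then obtain c w' where w: "w = c # w'" by (cases w) auto
  have "xs \<noteq> []" using 3(2) has_word_not_Nil by auto
  then obtain y where "y \<in> set xs" by (cases xs) auto
  then have "if b then y < x else x < y" "if c then y < x else x < y" using 3(2,3) by (auto simp: w)
  then have "b = c" by (cases b; cases c) auto
  moreover have "v = w'" using 3(2,3) by (intro "3.IH") (auto simp: w)
  ultimately show ?case by (simp add: w)
qed simp

lemma order_iso_Cons:
  "order_iso (x # xs) (y # ys) \<longleftrightarrow> order_iso xs ys \<and>
     (\<forall>i < length xs. (x < xs ! i \<longleftrightarrow> y < ys ! i) \<and> (xs ! i < x \<longleftrightarrow> ys ! i < y))"
  unfolding order_iso_def by (auto simp: All_less_Suc2)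

lemma has_word_order_iso: "order_iso xs ys \<Longrightarrow> has_word w xs \<Longrightarrow> has_word w ys"
proof (induction w xs arbitrary: ys rule: has_word.induct)
  case (3 b w x xs)
  obtain y ys' where ys: "ys = y # ys'" using 3(2) by (cases ys) (auto simp: order_iso_def)
  have iso: "order_iso xs ys'"
    "\<And>i. i < length xs \<Longrightarrow> (x < xs ! i \<longleftrightarrow> y < ys' ! i) \<and> (xs ! i < x \<longleftrightarrow> ys' ! i < y)"
    using 3(2) unfolding ys order_iso_Cons by blast+
  have len: "length xs = length ys'" using iso(1) unfolding order_iso_def by blast
  have "has_word w ys'" using "3.IH"[OF iso(1)] 3(3) by simp
  moreover have "if b then ys' ! i < y else y < ys' ! i" if "i < length ys'" for i
    using iso(2)[of i] 3(3) that len by (cases b) simp_all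
  ultimately show ?case by (simp add: ys all_set_conv_all_nth)
qed (auto simp: order_iso_def)

text \<open>Any two positions are compared by the letter at the earlier one, so the word fixes the
  order type.\<close>

lemma has_word_imp_order_iso: "has_word w xs \<Longrightarrow> has_word w ys \<Longrightarrow> order_iso xs ys"
proof (induction w xs arbitrary: ys rule: has_word.induct)
  case (1 xs)
  then show ?case by (auto simp: order_iso_def)
next
  case (3 b w x xs)
  obtain y ys' where ys: "ys = y # ys'" using 3(3) by (cases ys) auto
  have iso: "order_iso xs ys'" using 3(2,3) by (intro "3.IH") (auto simp: ys)
  then have "length xs = length ys'" unfolding order_iso_def by blast
  moreover have "if b then xs ! i < x \<and> ys' ! i < y else x < xs ! i \<and> y < ys' ! i"
    if "i < length xs" for i
    using 3(2,3) that calculation by (cases b) (auto simp: ys)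
  ultimately show ?case unfolding ys order_iso_Cons
    by (cases b) (auto simp: iso dest: less_asym)
qed simp

section \<open>Deleting entries versus deleting letters\<close>

lemma subseq_set_subset: "subseq xs ys \<Longrightarrow> set xs \<subseteq> set ys"
  by (induction rule: list_emb.induct) auto

text \<open>An extreme entry of a suffix stays extreme when later entries are deleted, so kept
  entries keep their letters, except that the last one kept loses any letter it had.\<close>

lemma has_word_subseq:
  "has_word u xs \<Longrightarrow> subseq t xs \<Longrightarrow> t \<noteq> [] \<Longrightarrow> \<exists>v. subseq v u \<and> has_word v t"
proof (induction u xs arbitrary: t rule: has_word.induct)
  case (1 xs)
  then have "length t = length xs" using list_emb_length[OF 1(2)] by (cases t) auto
  with 1(1) show ?case by (intro exI[of _ "[]"]) simp
next
  case (3 b w x xs)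
  from 3(2) have x: "\<forall>y \<in> set xs. if b then y < x else x < y" and w: "has_word w xs"
    by simp_all
  show ?case
  proof (cases "subseq t xs")
    case True
    then obtain v where "subseq v w" "has_word v t" using "3.IH"[OF w _ 3(4)] by blast
    then show ?thesis by blast
  next
    case False
    with 3(3,4) obtain t' where t: "t = x # t'" "subseq t' xs"
      by (cases t) (auto split: if_splits)
    show ?thesis
    proof (cases "t' = []")
      case True
      then show ?thesis using t by (intro exI[of _ "[]"]) simp
    next
      case False
      then obtain v where "subseq v w" "has_word v t'" using "3.IH"[OF w t(2)] by blast
      then show ?thesis using x subseq_set_subset[OF t(2)] t(1)
        by (intro exI[of _ "b # v"]) auto
    qed
  qed
qed simp

text \<open>Keep the entries whose letters make up \<open>v\<close>, together with the final entry,
  which carries no letter.\<close>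

lemma has_word_subword:
  "has_word u xs \<Longrightarrow> subseq v u \<Longrightarrow> \<exists>t. subseq t xs \<and> has_word v t"
proof (induction u xs arbitrary: v rule: has_word.induct)
  case (1 xs)
  then have "v = []" by simp
  then show ?case using 1(1) by (intro exI[of _ xs]) simp
next
  case (3 b w x xs)
  from 3(2) have x: "\<forall>y \<in> set xs. if b then y < x else x < y" and w: "has_word w xs"
    by simp_all
  show ?case
  proof (cases "subseq v w")
    case True
    then obtain t where "subseq t xs" "has_word v t" using "3.IH"[OF w] by blast
    then show ?thesis by blast
  next
    case False
    with 3(3) obtain v' where v: "v = b # v'" "subseq v' w"
      by (cases v) (auto split: if_splits)
    then obtain t where t: "subseq t xs" "has_word v' t" using "3.IH"[OF w] by blast
    then show ?thesis using x subseq_set_subset[OF t(1)] v(1)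
      by (intro exI[of _ "x # t"]) auto
  qed
qed simp


section \<open>Words with at most two runs\<close>

text \<open>Empty blocks and \<open>c = d\<close> are allowed, so this means at most two runs. It is
  the form that the rotation argument produces.\<close>

definition two_blocks :: "bool list \<Rightarrow> bool" where
  "two_blocks w \<longleftrightarrow> (\<exists>p q c d. w = replicate p c @ replicate q d)"

lemma two_blocks_card_runs:
  assumes "two_blocks w"
  shows "card (runs w) \<le> 2"
proof -
  obtain p q c d where w: "w = replicate p c @ replicate q d"
    using assms unfolding two_blocks_def by blast
  \<comment> \<open>A run is determined by its left end: a longer run with the same left end would
    cover the position where the letter changes.\<close>
  have "\<not> j < j'" if "(i, j) \<in> runs w" "(i, j') \<in> runs w" for i j j'
  proof
    assume "j < j'"
    have "i < j" "j = length w \<or> w ! j \<noteq> w ! i" using that(1) unfolding runs_def by blast+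
    moreover have "j' \<le> length w" "\<forall>l. i \<le> l \<and> l < j' \<longrightarrow> w ! l = w ! i"
      using that(2) unfolding runs_def by blast+
    ultimately show False using \<open>j < j'\<close> by (metis leD less_imp_le)
  qed
  then have "inj_on fst (runs w)"
    by (intro inj_onI) (metis linorder_neqE_nat prod.collapse)
  moreover have "fst ` runs w \<subseteq> {0, p}"
  proof clarsimp
    fix i j assume "(i, j) \<in> runs w" "0 < i"
    then have "i < j" "j \<le> length w" "w ! (i - 1) \<noteq> w ! i" unfolding runs_def by blast+
    then show "i = p" using \<open>0 < i\<close>
      by (cases i p rule: linorder_cases) (auto simp: w nth_append split: if_splits)
  qed
  ultimately have "card (runs w) \<le> card {0, p}"
    by (metis card_image card_mono finite.emptyI finite.insertI)
  also have "\<dots> \<le> 2" by (cases "p = 0") auto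
  finally show ?thesis .
qed

lemma subseq_replicate: "subseq v (replicate p c) \<Longrightarrow> v = replicate (length v) c"
  using subseq_set_subset[of v "replicate p c"] by (intro replicate_eqI) auto

lemma two_blocks_subseq:
  assumes "two_blocks u" "subseq v u"
  shows "two_blocks v"
proof -
  obtain p q c d where "subseq v (replicate p c @ replicate q d)"
    using assms unfolding two_blocks_def by blast
  then obtain v1 v2 where v: "v = v1 @ v2" "subseq v1 (replicate p c)" "subseq v2 (replicate q d)"
    by (rule subseq_appendE)
  show ?thesis
    using v(1) subseq_replicate[OF v(2)] subseq_replicate[OF v(3)] unfolding two_blocks_def by metis
qed

text \<open>The single witness \<open>z\<close> lies in every suffix that starts in
  \<open>xs\<close>, so it forces each of these letters to be \<open>c\<close>; the letters then
  compare \<open>xs\<close> with all of \<open>ys\<close>.\<close>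

lemma has_word_append_replicate:
  "has_word w (xs @ ys) \<Longrightarrow> z \<in> set ys \<Longrightarrow> (\<And>x. x \<in> set xs \<Longrightarrow> if c then z < x else x < z) \<Longrightarrow>
     \<exists>w'. w = replicate (length xs) c @ w' \<and> has_word w' ys \<and>
       (\<forall>x \<in> set xs. \<forall>y \<in> set ys. if c then y < x else x < y)"
proof (induction xs arbitrary: w)
  case (Cons x xs)
  have "w \<noteq> []" using Cons.prems(1,2) by auto
  then obtain b v where w: "w = b # v" by (cases w) auto
  have b: "if b then z < x else x < z" using Cons.prems(1,2) by (auto simp: w)
  have "if c then z < x else x < z" by (rule Cons.prems(3)) simp
  with b have "b = c" by (cases b; cases c) auto
  moreover obtain w' where "v = replicate (length xs) c @ w'" "has_word w' ys"
    "\<forall>x \<in> set xs. \<forall>y \<in> set ys. if c then y < x else x < y"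
    using Cons.IH[of v] Cons.prems by (auto simp: w)
  ultimately show ?case using Cons.prems(1) by (auto simp: w)
qed simp

text \<open>
  If a proper rotation \<open>A @ B\<close> of \<open>B @ A\<close> starts with its minimum \<open>a\<close>, then no entry of \<open>B\<close> can be
  the minimum of the suffix of \<open>B @ A\<close> that it starts, so all of them are maxima; hence no entry of
  \<open>A\<close> is the maximum of the suffix of \<open>A @ B\<close> that it starts, so \<open>A\<close> is increasing.  Dually if
  \<open>a\<close> is the maximum.
\<close>

lemma has_word_rotate_unique:
  assumes w: "has_word w xs" and v: "has_word v (rotate i xs)" and nb: "\<not> two_blocks w"
  shows "v = w"
proof -
  define k where "k = i mod length xs"
  define A where "A = drop k xs"
  define B where "B = take k xs"
  have rot: "rotate i xs = A @ B" by (simp add: A_def B_def k_def rotate_drop_take)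
  have xs: "xs = B @ A" by (simp add: A_def B_def)
  show ?thesis
  proof (cases "A = [] \<or> B = []")
    case True
    then have "rotate i xs = B @ A" using rot by auto
    then show ?thesis using v w xs has_word_unique_word by metis
  next
    case False
    then obtain a A1 where A: "A = a # A1" by (cases A) auto
    from False obtain b where b: "b \<in> set B" by (cases B) auto
    have "v \<noteq> []" using v b by (auto simp: rot A)
    then obtain c v' where c: "\<And>y. y \<in> set B \<Longrightarrow> if c then y < a else a < y"
      using v by (cases v) (auto simp: rot A)
    have c': "if \<not> c then a < x else x < a" if "x \<in> set B" for x
      using c[OF that] by (cases c) simp_all
    obtain w' where w': "w = replicate (length B) (\<not> c) @ w'" "has_word w' A"
      "\<forall>x \<in> set B. \<forall>y \<in> set A. if \<not> c then y < x else x < y"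
      using has_word_append_replicate[OF w[unfolded xs], of a "\<not> c"] c' unfolding A by fastforce
    \<comment> \<open>The witness \<open>b\<close> makes the letters of \<open>v\<close> on
      \<open>A'\<close> equal to \<open>c\<close>, which compares \<open>l\<close> with all of
      \<open>A'\<close>. Then \<open>l\<close> is the witness for \<open>w'\<close>, where no entry
      of \<open>B\<close> is left.\<close>
    obtain A' l where A': "A = A' @ [l]" using False by (metis rev_exhaust)
    have "has_word v (A' @ l # B)" using v by (simp add: rot A')
    from has_word_append_replicate[OF this, of b c]
    have "\<forall>x \<in> set A'. if c then l < x else x < l"
      using b w'(3) by (cases c) (auto simp: A')
    then obtain w'' where "w' = replicate (length A') c @ w''" "has_word w'' [l]"
      using has_word_append_replicate[of w' A' "[l]" l c] w'(2) by (auto simp: A')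
    then have "w = replicate (length B) (\<not> c) @ replicate (length A') c"
      using w' has_word_length[of w'' "[l]"] by simp
    then have False using nb unfolding two_blocks_def by blast
    then show ?thesis ..
  qed
qed

section \<open>Counting words without a given subsequence\<close>

lemma card_no_subseq:
  fixes w w' :: "bool list"
  shows "length w = length w' \<Longrightarrow>
    card {u. length u = n \<and> \<not> subseq w u} = card {u. length u = n \<and> \<not> subseq w' u}"
proof (induction n arbitrary: w w')
  case 0
  then show ?case by (cases w; cases w') (auto cong: conj_cong)
next
  case (Suc n)
  show ?case
  proof (cases w)
    case Nil
    then show ?thesis using Suc by simp
  next
    case (Cons a v)
    then obtain a' v' where w': "w' = a' # v'" using Suc by (cases w') auto
    \<comment> \<open>Greedy matching: if \<open>u\<close> starts with \<open>b\<close>, its tail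
      must avoid \<open>x\<close>, otherwise its tail must still avoid \<open>b # x\<close>. The
      recursion is the same for both values of \<open>b\<close>.\<close>
    have count: "card {u. length u = Suc n \<and> \<not> subseq (b # x) u} =
        card {u. length u = n \<and> \<not> subseq x u} + card {u. length u = n \<and> \<not> subseq (b # x) u}"
      for b :: bool and x
    proof -
      have fin: "finite {u :: bool list. length u = n \<and> P u}" for P
        by (rule finite_subset[OF _ finite_lists_length_eq[of UNIV n]]) auto
      have "{u. length u = Suc n \<and> \<not> subseq (b # x) u} =
          (#) b ` {u. length u = n \<and> \<not> subseq x u} \<union>
          (#) (\<not> b) ` {u. length u = n \<and> \<not> subseq (b # x) u}"
        by (auto simp: length_Suc_conv image_iff)
      moreover have "card \<dots> = card {u. length u = n \<and> \<not> subseq x u} +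
          card {u. length u = n \<and> \<not> subseq (b # x) u}"
        by (subst card_Un_disjoint) (auto simp: fin card_image)
      ultimately show ?thesis by simp
    qed
    show ?thesis
      using Suc.IH[of v v'] Suc.IH[of w w'] Suc.prems unfolding Cons w' count by simp
  qed
qed


section \<open>Circular permutations avoiding 1342\<close>

lemma subseq_rotateD:
  assumes "subseq t (rotate i s)"
  shows "\<exists>m. subseq (rotate m t) s"
proof -
  define k where "k = i mod length s"
  have "subseq t (drop k s @ take k s)"
    using assms by (simp add: k_def rotate_drop_take)
  then obtain t1 t2 where t: "t = t1 @ t2" "subseq t1 (drop k s)" "subseq t2 (take k s)"
    by (auto elim: subseq_appendE)
  have "subseq (t2 @ t1) (take k s @ drop k s)"
    using t by (intro list_emb_append_mono)
  moreover have "rotate (length t1) t = t2 @ t1" by (simp add: t rotate_append)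
  ultimately show ?thesis by (metis append_take_drop_id)
qed

text \<open>The rotation is moved from the containing permutation to the pattern, so that only words
  of rotations of \<open>p\<close> have to be examined.\<close>

lemma circ_contains_has_word:
  assumes "circ_contains (circ xs) (circ p)" "has_word u xs" "p \<noteq> []"
  shows "\<exists>v j. subseq v u \<and> has_word v (rotate j p)"
proof -
  obtain i t where t: "subseq t (rotate i xs)" "order_iso t p"
    using assms(1) by (auto simp: circ_contains_circ contains_def)
  then obtain m where m: "subseq (rotate m t) xs" using subseq_rotateD by blast
  have "t \<noteq> []" using t(2) assms(3) by (auto simp: order_iso_def)
  then obtain v where "subseq v u" "has_word v (rotate m t)"
    using has_word_subseq[OF assms(2) m] by auto
  then show ?thesis using has_word_order_iso order_iso_rotate[OF t(2)] by blast
qed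

lemma circ_contains_perm_of_word_iff:
  assumes "\<not> two_blocks w"
  shows "circ_contains (circ (perm_of_word u)) (circ (perm_of_word w)) \<longleftrightarrow> subseq w u"
proof
  assume "circ_contains (circ (perm_of_word u)) (circ (perm_of_word w))"
  then obtain v j where "subseq v u" "has_word v (rotate j (perm_of_word w))"
    using circ_contains_has_word[OF _ has_word_perm_of_word has_word_not_Nil[OF has_word_perm_of_word]]
    by blast
  then show "subseq w u"
    using has_word_rotate_unique[OF has_word_perm_of_word _ assms] by blast
next
  assume "subseq w u"
  then obtain t where "subseq t (perm_of_word u)" "has_word w t"
    using has_word_subword[OF has_word_perm_of_word] by blast
  then have "contains (rotate 0 (perm_of_word u)) (perm_of_word w)"
    using has_word_imp_order_iso[OF _ has_word_perm_of_word] by (auto simp: contains_def)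
  then show "circ_contains (circ (perm_of_word u)) (circ (perm_of_word w))"
    unfolding circ_contains_circ by blast
qed

lemma perm_of_word_avoids_1342: "\<not> circ_contains (circ (perm_of_word u)) (circ [1,3,4,2])"
proof
  assume "circ_contains (circ (perm_of_word u)) (circ [1,3,4,2])"
  then obtain v j where v: "has_word v (rotate j [1,3,4,2])"
    using circ_contains_has_word[OF _ has_word_perm_of_word] by blast
  then have "length v = 3" using has_word_length[OF v] by simp
  then obtain x y z where xyz: "v = [x, y, z]" by (auto simp: numeral_eq_Suc length_Suc_conv)
  have "rotate j [1,3,4,2] = rotate (j mod 4) [1,3,4,2::nat]"
    by (subst rotate_conv_mod) simp
  moreover have rot: "rotate 0 [1,3,4,2] = [1,3,4,2::nat]" "rotate 1 [1,3,4,2] = [3,4,2,1::nat]"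
      "rotate 2 [1,3,4,2] = [4,2,1,3::nat]" "rotate 3 [1,3,4,2] = [2,1,3,4::nat]"
    by (simp_all add: numeral_eq_Suc)
  moreover have "j mod 4 = 0 \<or> j mod 4 = 1 \<or> j mod 4 = 2 \<or> j mod 4 = 3" by presburger
  ultimately have "rotate j [1,3,4,2] \<in> {[1,3,4,2], [3,4,2,1], [4,2,1,3], [2,1,3,4::nat]}"
    by (elim disjE) (simp_all only: rot insert_iff simp_thms)
  \<comment> \<open>In each of 1342, 3421, 4213 and 2134 one of the first two entries has both a
    smaller and a larger entry after it.\<close>
  then show False
    using v unfolding xyz by (elim insertE emptyE) (simp_all split: if_splits)
qed

lemma circ_rotate: "circ (rotate i xs) = circ xs"
proof -
  have "circ (rotate i ys) \<subseteq> circ ys" for i and ys :: "nat list"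
    by (auto simp: circ_def rotate_rotate)
  moreover have "\<exists>m. rotate m (rotate i xs) = xs"
    by (metis append_take_drop_id rotate_append rotate_drop_take)
  ultimately show ?thesis by (metis subset_antisym)
qed

lemma subseq_pair:
  "y \<in> set xs \<Longrightarrow> z \<in> set xs \<Longrightarrow> y \<noteq> z \<Longrightarrow> subseq [y, z] xs \<or> subseq [z, y] xs"
  by (induction xs) (auto simp: subseq_singleton_left)

lemma ex_has_word:
  assumes "xs \<noteq> []" "distinct xs"
    and "\<And>a b c. subseq [a, b, c] xs \<Longrightarrow> \<not> (b < a \<and> a < c) \<and> \<not> (c < a \<and> a < b)"
  shows "\<exists>w. has_word w xs"
  using assms
proof (induction xs)
  case (Cons x xs)
  show ?case
  proof (cases "xs = []")
    case True
    then show ?thesis by (auto intro!: exI[of _ "[]"])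
  next
    case False
    then obtain w where w: "has_word w xs"
      using Cons by (metis distinct.simps(2) list_emb_Cons)
    \<comment> \<open>A smaller \<open>y\<close> and a larger \<open>z\<close> after
      \<open>x\<close> form a 213 or a 231 with \<open>x\<close>, depending on which comes
      first.\<close>
    have "(\<forall>y \<in> set xs. y < x) \<or> (\<forall>y \<in> set xs. x < y)"
    proof (rule ccontr)
      assume "\<not> ?thesis"
      then obtain y z where yz: "y \<in> set xs" "z \<in> set xs" "y < x" "x < z"
        using Cons.prems(2) by (metis distinct.simps(2) linorder_neqE_nat)
      then have "subseq [y, z] xs \<or> subseq [z, y] xs"
        by (intro subseq_pair) auto
      then show False using Cons.prems(3)[of x y z] Cons.prems(3)[of x z y] yz by auto
    qed
    then have "has_word (True # w) (x # xs) \<or> has_word (False # w) (x # xs)"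
      using w by auto
    then show ?thesis by blast
  qed
qed simp

lemma subseq3_append:
  "subseq [a, b, c] (xs @ ys) \<Longrightarrow>
     subseq [a, b, c] ys \<or> a \<in> set xs \<and> b \<in> set ys \<or> subseq [a, b] xs"
proof (induction xs)
  case (Cons x xs)
  show ?case
  proof (cases "a = x")
    case False
    then show ?thesis using Cons by auto
  next
    case True
    then have "subseq [b, c] (xs @ ys)" using Cons.prems by simp
    then have "b \<in> set xs \<or> b \<in> set ys" using subseq_set_subset by fastforce
    then show ?thesis using True by (auto simp: subseq_singleton_left)
  qed
qed simp

text \<open>
  A sequence is described by a word iff it avoids 213 and 231 as linear patterns.  Starting at the
  minimum \<open>m\<close> only 213 can occur, and this forces a descent in \<open>X\<close>; starting at the maximum \<open>M\<close>
  only 231 can occur, and this forces an ascent in \<open>Y\<close>.  As \<open>X < Y\<close>, both together form a 2134, a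
  rotation of 1342.
\<close>

lemma avoids_1342_has_word:
  fixes m M :: nat
  assumes dist: "distinct (m # X @ M # Y)"
    and min: "\<And>x. x \<in> set (X @ M # Y) \<Longrightarrow> m < x"
    and max: "\<And>x. x \<in> set (m # X @ Y) \<Longrightarrow> x < M"
    and av: "\<And>xs a b c d. xs \<in> {m # X @ M # Y, M # Y @ m # X} \<Longrightarrow> subseq [a, b, c, d] xs \<Longrightarrow>
      \<not> (a < d \<and> d < b \<and> b < c) \<and> \<not> (c < b \<and> b < d \<and> d < a) \<and> \<not> (b < a \<and> a < c \<and> c < d)"
  shows "\<exists>w. has_word w (m # X @ M # Y) \<or> has_word w (M # Y @ m # X)"
proof (rule ccontr)
  let ?xs = "m # X @ M # Y" and ?ys = "M # Y @ m # X"
  assume no: "\<not> ?thesis"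
  have dist': "distinct ?ys" using dist by auto
  \<comment> \<open>Otherwise \<open>m\<close>, \<open>x\<close>, \<open>M\<close>, \<open>y\<close>
    form a 1342.\<close>
  have XY: "x < y" if "x \<in> set X" "y \<in> set Y" for x y
  proof -
    have "subseq ([m, x] @ [M, y]) ((m # X) @ M # Y)"
      using that by (intro list_emb_append_mono) (simp_all add: subseq_singleton_left)
    then have "\<not> y < x" using av[of ?xs m x M y] that min max by auto
    moreover have "x \<noteq> y" using that dist by auto
    ultimately show ?thesis by simp
  qed
  have sub4: "subseq [x, a, b, c] (x # zs)" if "subseq [a, b, c] zs" for x a b c :: nat and zs
    using that by simp
  obtain p q where pq: "subseq [p, q] X" "q < p"
  proof -
    obtain a b c where abc: "subseq [a, b, c] ?xs" "b < a \<and> a < c \<or> c < a \<and> a < b"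
      using ex_has_word[of ?xs] dist no by blast
    have set: "{a, b, c} \<subseteq> set ?xs" using subseq_set_subset[OF abc(1)] by auto
    have "a \<noteq> m" using set abc(2) min by (auto dest: less_asym)
    then have sub: "subseq [a, b, c] (X @ M # Y)" using abc(1) by (auto split: if_splits)
    \<comment> \<open>The minimum \<open>m\<close> followed by a 231 would be a 1342, so the triple
      is a 213.\<close>
    from subseq_set_subset[OF sub] have ord: "b < a" "a < c"
      using av[of ?xs m a b c] sub4[OF sub, of m] abc(2) min[of c] by auto
    have "a \<noteq> M" using set ord max by (auto dest: less_asym)
    \<comment> \<open>A 213 inside \<open>Y\<close> would follow \<open>M\<close> in
      \<open>?ys\<close> and give a 4213. So \<open>a\<close> lies in \<open>X\<close>, and
      \<open>b < a\<close> puts \<open>b\<close> there too.\<close>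
    have "\<not> subseq [a, b, c] (M # Y)"
    proof
      assume *: "subseq [a, b, c] (M # Y)"
      with \<open>a \<noteq> M\<close> have *: "subseq [a, b, c] Y" by (auto split: if_splits)
      then have "c \<in> set Y" using subseq_set_subset by fastforce
      moreover have "subseq [M, a, b, c] ?ys"
        using * by (metis append_Cons list_emb_append_mono list_emb_Nil append_Nil2 subseq_Cons2)
      ultimately show False using av[of ?ys M a b c] ord max[of c] by auto
    qed
    moreover have "b \<notin> set (M # Y)" if "a \<in> set X"
      using that ord XY max[of a] by (auto dest: less_asym)
    ultimately have "subseq [a, b] X" using subseq3_append[OF sub] by blast
    then show ?thesis using ord that by blast
  qed
  obtain a b where ab: "subseq [a, b] Y" "a < b"
  proof -
    obtain a b c where abc: "subseq [a, b, c] ?ys" "b < a \<and> a < c \<or> c < a \<and> a < b"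
      using ex_has_word[of ?ys] dist' no by blast
    have set: "{a, b, c} \<subseteq> set ?ys" using subseq_set_subset[OF abc(1)] by auto
    have "a \<noteq> M" using set abc(2) max by (auto dest: less_asym)
    then have sub: "subseq [a, b, c] (Y @ m # X)" using abc(1) by (auto split: if_splits)
    \<comment> \<open>The maximum \<open>M\<close> followed by a 213 would be a 4213, so the triple
      is a 231.\<close>
    from subseq_set_subset[OF sub] have ord: "c < a" "a < b"
      using av[of ?ys M a b c] sub4[OF sub, of M] abc(2) max[of c] by auto
    have "a \<noteq> m" using set ord min by (auto dest: less_asym)
    have "\<not> subseq [a, b, c] (m # X)"
    proof
      assume *: "subseq [a, b, c] (m # X)"
      with \<open>a \<noteq> m\<close> have *: "subseq [a, b, c] X" by (auto split: if_splits)
      then have "c \<in> set X" using subseq_set_subset by fastforce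
      moreover have "subseq [m, a, b, c] ?xs"
        using * by (metis append_Cons list_emb_append_mono list_emb_Nil append_Nil2 subseq_Cons2)
      ultimately show False using av[of ?xs m a b c] ord min[of c] by auto
    qed
    moreover have "b \<notin> set (m # X)" if "a \<in> set Y"
      using that ord XY min[of a] by (auto dest: less_asym)
    ultimately have "subseq [a, b] Y" using subseq3_append[OF sub] by blast
    then show ?thesis using ord that by blast
  qed
  have "subseq ([p, q] @ [a, b]) ((m # X) @ M # Y)"
    using pq(1) ab(1) by (intro list_emb_append_mono list_emb_Cons)
  moreover have "p < a" using XY subseq_set_subset[OF pq(1)] subseq_set_subset[OF ab(1)] by simp
  ultimately show False using av[of ?xs p q a b] pq ab by auto
qed

lemma avoids_1342_perm_of_word:
  assumes S: "S \<in> circ_perms n" and n: "n \<ge> 1" and av: "\<not> circ_contains S (circ [1,3,4,2])"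
  shows "\<exists>u. length u = n - 1 \<and> S = circ (perm_of_word u)"
proof -
  obtain p where p: "set p = {1..n}" "distinct p" "S = circ p"
    using S by (auto simp: circ_perms_def permutations_of_set_def)
  then obtain P Q where PQ: "p = P @ 1 # Q" using n by (metis atLeastAtMost_iff order_refl split_list)
  have "rotate (length P) p = 1 # Q @ P" by (simp add: PQ rotate_append)
  then have S1: "S = circ (1 # Q @ P)" using circ_rotate p(3) by metis
  have S2: "set (1 # Q @ P) = {1..n}" "distinct (1 # Q @ P)" using p by (auto simp: PQ)
  have "\<exists>w xs. has_word w xs \<and> S = circ xs \<and> set xs = {1..n} \<and> distinct xs"
  \<comment> \<open>For \<open>n = 1\<close> minimum and maximum coincide and cannot both be split
    off.\<close>
  proof (cases "n = 1")
    case True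
    have "set (Q @ P) = {1..n} - {1}" using p by (auto simp: PQ)
    then have "Q @ P = []" using True by simp
    then have "has_word [] (1 # Q @ P)" by simp
    then show ?thesis using S1 S2 by blast
  next
    case False
    then have "n \<in> set (Q @ P)" using p n by (auto simp: PQ)
    then obtain X Y where XY: "Q @ P = X @ n # Y" by (metis split_list)
    let ?xs = "1 # X @ n # Y" and ?ys = "n # Y @ 1 # X"
    have "rotate (length (1 # X)) ((1 # X) @ n # Y) = ?ys" by (simp only: rotate_append) simp
    then have circ: "S = circ xs" if "xs \<in> {?xs, ?ys}" for xs
      using that S1 circ_rotate[of "length (1 # X)" ?xs] by (auto simp: XY)
    have set: "set ?xs = {1..n}" "set ?ys = {1..n}" and dist: "distinct ?xs" "distinct ?ys"
      using S2 unfolding XY by auto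
    have no: "\<not> order_iso t (rotate j [1,3,4,2])" if "xs \<in> {?xs, ?ys}" "subseq t xs" for xs t j
    proof
      assume "order_iso t (rotate j [1,3,4,2])"
      then have "contains xs (rotate j [1,3,4,2])" using that(2) by (auto simp: contains_def)
      moreover have "xs \<in> S" unfolding circ[OF that(1)] by (auto simp: circ_def intro: exI[of _ 0])
      ultimately show False using av by (auto simp: circ_contains_def circ_def)
    qed
    \<comment> \<open>Rotations 0, 2 and 3 are 1342, 4213 and 2134, the patterns excluded in
      \<open>avoids_1342_has_word\<close>.\<close>
    have iso: "order_iso [a, b, c, d] (rotate 0 [1,3,4,2])" if "a < d \<and> d < b \<and> b < c" for a b c d
      using that by (simp add: order_iso_def numeral_eq_Suc All_less_Suc)
    have iso2: "order_iso [a, b, c, d] (rotate 2 [1,3,4,2])" if "c < b \<and> b < d \<and> d < a" for a b c d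
      using that by (simp add: order_iso_def numeral_eq_Suc All_less_Suc)
    have iso3: "order_iso [a, b, c, d] (rotate 3 [1,3,4,2])" if "b < a \<and> a < c \<and> c < d" for a b c d
      using that by (simp add: order_iso_def numeral_eq_Suc All_less_Suc)
    have "\<exists>w. has_word w ?xs \<or> has_word w ?ys"
    proof (rule avoids_1342_has_word)
      fix x assume x: "x \<in> set (X @ n # Y)"
      then have "x \<in> {1..n}" unfolding set(1)[symmetric] by auto
      moreover have "x \<noteq> 1" using dist x by auto
      ultimately show "1 < x" by auto
    next
      fix x assume x: "x \<in> set (1 # X @ Y)"
      then have "x \<in> {1..n}" unfolding set(1)[symmetric] by auto
      moreover have "x \<noteq> n" using dist x by auto
      ultimately show "x < n" by auto
    next
      fix xs a b c d
      assume "xs \<in> {?xs, ?ys}" "subseq [a, b, c, d] xs"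
      then have n: "\<not> order_iso [a, b, c, d] (rotate j [1,3,4,2])" for j by (rule no)
      show "\<not> (a < d \<and> d < b \<and> b < c) \<and> \<not> (c < b \<and> b < d \<and> d < a) \<and> \<not> (b < a \<and> a < c \<and> c < d)"
        by (rule conjI[OF contrapos_nn[OF n iso] conjI[OF contrapos_nn[OF n iso2] contrapos_nn[OF n iso3]]])
    qed (rule dist)
    then obtain w xs where "has_word w xs" and xs: "xs \<in> {?xs, ?ys}" by blast
    moreover have "S = circ xs" by (rule circ[OF xs])
    moreover have "set xs = {1..n}" "distinct xs" using xs set dist by auto
    ultimately show ?thesis by blast
  qed
  then obtain w xs where w: "has_word w xs" "S = circ xs" "set xs = {1..n}" "distinct xs" by blast
  have "length w + 1 = n" using has_word_length[OF w(1)] distinct_card[OF w(4)] w(3) by simp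
  moreover have "xs = perm_of_word w"
    using has_word_unique_perm[OF w(1,4)] w(3) calculation by (simp add: perm_of_word_def)
  ultimately show ?thesis using w(2) by (intro exI[of _ w]) auto
qed

section \<open>Counting the avoiding circular permutations\<close>

lemma Av_1342_perm_of_word:
  assumes n: "n \<ge> 1" and w: "\<not> two_blocks w"
  shows "Av n {circ [1,3,4,2], circ (perm_of_word w)} =
    (\<lambda>u. circ (perm_of_word u)) ` {u. length u = n - 1 \<and> \<not> subseq w u}" (is "?L = ?R")
proof
  show "?L \<subseteq> ?R"
    using avoids_1342_perm_of_word[OF _ n] circ_contains_perm_of_word_iff[OF w]
    by (fastforce simp: Av_def)
  have "circ (perm_of_word u) \<in> circ_perms n" if "length u = n - 1" for u
    using perm_of_word_permutation[of u] that n by (auto simp: circ_perms_def)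
  then show "?R \<subseteq> ?L"
    using perm_of_word_avoids_1342 circ_contains_perm_of_word_iff[OF w] by (auto simp: Av_def)
qed

text \<open>The restriction is on \<open>w\<close> alone, so this also separates the images of words
  with at most two runs from all other images.\<close>

lemma circ_perm_of_word_inject:
  assumes "circ (perm_of_word u) = circ (perm_of_word w)" "\<not> two_blocks w"
  shows "u = w"
proof -
  have "perm_of_word u \<in> circ (perm_of_word u)" by (auto simp: circ_def intro: exI[of _ 0])
  then obtain i where "perm_of_word u = rotate i (perm_of_word w)"
    using assms(1) by (auto simp: circ_def)
  then show ?thesis
    using has_word_rotate_unique[OF has_word_perm_of_word _ assms(2)] has_word_perm_of_word[of u]
    by metis
qed

text \<open>Injectivity fails only on \<open>T\<close>, whose words are counted with their images
  instead. Both terms in \<open>T\<close> depend on \<open>n\<close> alone and cancel when two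
  patterns are compared; the additive form avoids subtraction on naturals.\<close>

lemma card_Av_1342_perm_of_word:
  assumes n: "n \<ge> 1" and w: "\<not> two_blocks w"
  defines "T \<equiv> {u. length u = n - 1 \<and> two_blocks u}"
  shows "card (Av n {circ [1,3,4,2], circ (perm_of_word w)}) + card T =
    card ((\<lambda>u. circ (perm_of_word u)) ` T) + card {u. length u = n - 1 \<and> \<not> subseq w u}"
proof -
  let ?g = "\<lambda>u. circ (perm_of_word u)"
  define N where "N = {u. length u = n - 1 \<and> \<not> subseq w u \<and> \<not> two_blocks u}"
  have fin: "finite {u :: bool list. length u = n - 1 \<and> P u}" for P
    by (rule finite_subset[OF _ finite_lists_length_eq[of UNIV "n - 1"]]) auto
  \<comment> \<open>Subwords of words in \<open>T\<close> have at most two runs, so none of them is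
    \<open>w\<close>.\<close>
  have un: "{u. length u = n - 1 \<and> \<not> subseq w u} = T \<union> N"
    using two_blocks_subseq w by (auto simp: T_def N_def)
  have "inj_on ?g N"
    using circ_perm_of_word_inject by (auto simp: N_def inj_on_def)
  moreover have "?g t \<noteq> ?g u" if "t \<in> T" "u \<in> N" for t u
    using circ_perm_of_word_inject[of t u] that by (auto simp: N_def T_def)
  then have "?g ` T \<inter> ?g ` N = {}" by blast
  moreover have finT: "finite T" and finN: "finite N" unfolding T_def N_def by (rule fin)+
  ultimately have "card (?g ` (T \<union> N)) = card (?g ` T) + card N"
    unfolding image_Un by (simp add: card_Un_disjoint card_image)
  moreover have "T \<inter> N = {}" by (auto simp: T_def N_def)
  then have "card (T \<union> N) = card T + card N" using finT finN by (simp add: card_Un_disjoint)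
  ultimately show ?thesis using Av_1342_perm_of_word[OF n w] un by simp
qed

theorem theorem3p15:
  fixes k :: nat and w w' :: "bool list"
  assumes "k \<ge> 1"
    and "length w = k" and "card (runs w) > 2"
    and "length w' = k" and "card (runs w') > 2"
  shows "Wilf_equivalent {circ [1,3,4,2], circ (perm_of_word w)}
                         {circ [1,3,4,2], circ (perm_of_word w')}"
proof -
  have "\<not> two_blocks w" "\<not> two_blocks w'"
    using assms two_blocks_card_runs[of w] two_blocks_card_runs[of w'] by linarith+
  then have "card (Av n {circ [1,3,4,2], circ (perm_of_word w)}) =
      card (Av n {circ [1,3,4,2], circ (perm_of_word w')})" if "n \<ge> 1" for n
    using card_Av_1342_perm_of_word[of n w] card_Av_1342_perm_of_word[of n w'] that
      card_no_subseq[of w w' "n - 1"] assms(2,4) by linarith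
  then show ?thesis unfolding Wilf_equivalent_def by blast
qed

end
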